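(* Let $k \ge 1$, $m = 4k+2$, $\theta = 2\pi/m$, and let $P$ be a finite point set in general position. For any two vertices $u, w \in P$, let $M$ be the midpoint of the side of $T_{uw}$ opposite $u$ and let $\alpha$ be the unsigned angle between $uw$ and $uM$. Then the $\theta_m$-graph on $P$ contains a path from $u$ to $w$ of length at most $$\left(\frac{1 + \sin(\theta/2)}{\cos(\theta/2)}\cos\alpha + \sin\alpha\right)|uw|.$$
   Context: Cones: for $m \ge 2$, $\theta = 2\pi/m$; around each point $u$ draw $m$ rays with consecutive angular separation $\theta$, oriented so the vertical upward ray from $u$ bisects a cone, called $C_0^u$; cones are numbered $C_0^u,\dots,C_{m-1}^u$ clockwise, with the same orientation at every point. General position: no two points on a line parallel to a cone boundary ray, no two points on a line perpendicular to a cone bisector, no three points collinear. The $\theta_m$-graph on $P$: vertex set $P$; for each $u \in P$ and each cone $C_i^u$ containing a point of $P\setminus\{u\}$, add an edge from $u$ to the point $v \in C_i^u$ whose orthogonal projection onto the bisector of $C_i^u$ is closest to $u$. Edges are weighted by Euclidean length. Canonical triangle: if $w$ lies in cone $C$ of $u$, $T_{uw}$ is the triangle bounded by the two boundary rays of $C$ and the line through $w$ perpendicular to the bisector of $C$. *)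

theory Defs
  imports "HOL-Analysis.Analysis"
begin

type_synonym point = "real \<times> real"

definition cone_angle :: "nat \<Rightarrow> real" where
  "cone_angle m = 2 * pi / real m"

text \<open>Unit direction obtained by rotating the upward vertical direction (0,1)
  clockwise by angle phi.\<close>
definition cw_dir :: "real \<Rightarrow> point" where
  "cw_dir phi = (sin phi, cos phi)"

text \<open>Bisector direction of cone C_i (cones numbered clockwise, C_0 bisected
  by the upward vertical ray).\<close>
definition bisector :: "nat \<Rightarrow> nat \<Rightarrow> point" where
  "bisector m i = cw_dir (real i * cone_angle m)"

text \<open>Direction of the boundary ray of cone C_i on its clockwise side; as i ranges
  over 0..m-1 these are all m boundary rays.\<close>
definition boundary_dir :: "nat \<Rightarrow> nat \<Rightarrow> point" where
  "boundary_dir m i = cw_dir (real i * cone_angle m + cone_angle m / 2)"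

definition in_cone :: "nat \<Rightarrow> nat \<Rightarrow> point \<Rightarrow> point \<Rightarrow> bool" where
  "in_cone m i u v \<longleftrightarrow> i < m \<and> v \<noteq> u \<and>
     cos (cone_angle m / 2) * norm (v - u) \<le> (v - u) \<bullet> bisector m i"

definition proj_len :: "nat \<Rightarrow> nat \<Rightarrow> point \<Rightarrow> point \<Rightarrow> real" where
  "proj_len m i u v = (v - u) \<bullet> bisector m i"

definition cross2 :: "point \<Rightarrow> point \<Rightarrow> real" where
  "cross2 a b = fst a * snd b - snd a * fst b"

definition collinear3 :: "point \<Rightarrow> point \<Rightarrow> point \<Rightarrow> bool" where
  "collinear3 a b c \<longleftrightarrow> cross2 (b - a) (c - a) = 0"

definition general_position :: "nat \<Rightarrow> point set \<Rightarrow> bool" where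
  "general_position m P \<longleftrightarrow>
     (\<forall>p\<in>P. \<forall>q\<in>P. p \<noteq> q \<longrightarrow>
        (\<forall>i<m. cross2 (p - q) (boundary_dir m i) \<noteq> 0) \<and>
        (\<forall>i<m. (p - q) \<bullet> bisector m i \<noteq> 0)) \<and>
     (\<forall>a\<in>P. \<forall>b\<in>P. \<forall>c\<in>P. a \<noteq> b \<and> a \<noteq> c \<and> b \<noteq> c \<longrightarrow> \<not> collinear3 a b c)"

definition theta_edge :: "nat \<Rightarrow> point set \<Rightarrow> point \<Rightarrow> point \<Rightarrow> bool" where
  "theta_edge m P u v \<longleftrightarrow> u \<in> P \<and> v \<in> P \<and>
     (\<exists>i<m. in_cone m i u v \<and>
        (\<forall>x\<in>P. in_cone m i u x \<longrightarrow> proj_len m i u v \<le> proj_len m i u x))"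

definition theta_adj :: "nat \<Rightarrow> point set \<Rightarrow> point \<Rightarrow> point \<Rightarrow> bool" where
  "theta_adj m P u v \<longleftrightarrow> theta_edge m P u v \<or> theta_edge m P v u"

definition is_theta_path :: "nat \<Rightarrow> point set \<Rightarrow> point list \<Rightarrow> point \<Rightarrow> point \<Rightarrow> bool" where
  "is_theta_path m P ps u w \<longleftrightarrow> ps \<noteq> [] \<and> hd ps = u \<and> last ps = w \<and>
     (\<forall>j. Suc j < length ps \<longrightarrow> theta_adj m P (ps ! j) (ps ! Suc j))"

fun path_length :: "point list \<Rightarrow> real" where
  "path_length (a # b # rest) = dist a b + path_length (b # rest)"
| "path_length _ = 0"

text \<open>Midpoint of the side of the canonical triangle T_uw opposite u, where w is in
  cone C_i^u: it is the foot on the bisector of the perpendicular line through w.\<close>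
definition canon_mid :: "nat \<Rightarrow> nat \<Rightarrow> point \<Rightarrow> point \<Rightarrow> point" where
  "canon_mid m i u w = u + proj_len m i u w *\<^sub>R bisector m i"

definition vec_angle :: "point \<Rightarrow> point \<Rightarrow> real" where
  "vec_angle a b = arccos ((a \<bullet> b) / (norm a * norm b))"

end

(* Induction on the height of the canonical triangle T_uw with apex u and base corners a
   (left) and b (right). The claim proved is |path| <= max (|ua| + |aw|) (|ub| + |bw|),
   strengthened: if the part of T_uw to the left (right) of the opposite cone of w is empty,
   then |ub| + |bw| (|ua| + |aw|) suffices. Let v be the neighbour of u in the cone. If w lies
   in the parallel cone of v, the bounds for u, v and for v, w add up. Otherwise w lies in a
   cone of v turned by j steps, 1 <= j <= k. For j < k both corner bounds of T_vw are at most
   the bound required of v, w. For j = k apply the induction hypothesis to T_wv: its lower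
   side region is empty because v is closest to u, and its upper corner gives exactly the
   required bound.

   Since m = 4k + 2, normals of cone boundaries are themselves cone bisectors, so cones,
   heights and side regions are all described by scalar products with directions that are
   integer multiples of theta, and |ua| + |aw|, |ub| + |bw| by half-integer multiples. *)

theory Submission
  imports Defs
begin

section \<open>Linear functionals along directions of the plane\<close>

definition along :: "real \<Rightarrow> point \<Rightarrow> real" where
  "along \<phi> p = p \<bullet> cw_dir \<phi>"

lemma along_eq: "along \<phi> p = fst p * sin \<phi> + snd p * cos \<phi>"
  by (cases p) (simp add: along_def cw_dir_def)

lemma along_diff: "along \<phi> (p - q) = along \<phi> p - along \<phi> q"
  by (simp add: along_def inner_diff_left)

lemma along_add_pi: "along (\<phi> + pi) p = - along \<phi> p"
  by (simp add: along_eq)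

lemma along_add_angle:
  "along (a + b) p = cos b * along a p + sin b * along (a + pi / 2) p"
  by (simp add: along_eq sin_add cos_add algebra_simps)

lemma along_pythagoras: "(along a p)\<^sup>2 + (along (a + pi / 2) p)\<^sup>2 = (norm p)\<^sup>2"
proof -
  have "(along a p)\<^sup>2 + (along (a + pi / 2) p)\<^sup>2
      = ((fst p)\<^sup>2 + (snd p)\<^sup>2) * ((sin a)\<^sup>2 + (cos a)\<^sup>2)"
    by (simp add: along_eq sin_add cos_add algebra_simps power2_eq_square
          del: sin_cos_squared_add sin_cos_squared_add2 sin_cos_squared_add3)
  also have "\<dots> = (fst p)\<^sup>2 + (snd p)\<^sup>2" by simp
  also have "\<dots> = (norm p)\<^sup>2" by (simp add: norm_prod_def)
  finally show ?thesis .
qed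

text \<open>Three linear functionals on the plane are dependent, with sines of angle differences as
  coefficients. Where these are nonnegative, signs known at two directions pass to those in
  between.\<close>

lemma along_sine_rule:
  "sin (b - a) * along x p = sin (b - x) * along a p + sin (x - a) * along b p"
  by (simp add: along_eq sin_diff algebra_simps)

text \<open>In components along and across direction \<open>a\<close> the product is a difference of
  squares. This turns a pair of half-plane conditions into a comparison of a height with a multiple
  of the norm.\<close>

lemma along_mult:
  "along (a + b) p * along (a - b) p = (along a p)\<^sup>2 - (sin b)\<^sup>2 * (norm p)\<^sup>2"
proof -
  define F G where "F = along a p" and "G = along (a + pi / 2) p"
  have m: "along (a - b) p = cos b * F - sin b * G"
    using along_add_angle[of a "- b" p] by (simp add: F_def G_def)
  have "along (a + b) p * along (a - b) p = (cos b * F + sin b * G) * (cos b * F - sin b * G)"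
    unfolding m F_def G_def by (simp only: along_add_angle[of a b])
  also have "\<dots> = (cos b)\<^sup>2 * F\<^sup>2 - (sin b)\<^sup>2 * G\<^sup>2"
    by (simp add: algebra_simps power2_eq_square)
  also have "\<dots> = F\<^sup>2 - (sin b)\<^sup>2 * (F\<^sup>2 + G\<^sup>2)"
    by (simp add: cos_squared_eq algebra_simps)
  finally show ?thesis by (simp add: F_def G_def along_pythagoras)
qed

lemma along_difference:
  "along x p - along y p = 2 * sin ((y - x) / 2) * along ((x + y) / 2 - pi / 2) p"
proof -
  define h where "h = (x + y) / 2"
  define d where "d = (y - x) / 2"
  have xy: "x = h - d" "y = h + d" by (simp_all add: h_def d_def field_simps)
  have "along (h - d) p - along (h + d) p = 2 * sin d * along (h - pi / 2) p"
    by (simp add: along_eq sin_diff cos_diff sin_add cos_add algebra_simps)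
  then show ?thesis by (simp add: xy)
qed

section \<open>Walks carrying their length, and reachability within a length\<close>

inductive theta_walk :: "nat \<Rightarrow> point set \<Rightarrow> point \<Rightarrow> point \<Rightarrow> real \<Rightarrow> bool"
  for m P where
  refl: "theta_walk m P u u 0"
| step: "theta_adj m P u v \<Longrightarrow> theta_walk m P v w d \<Longrightarrow> theta_walk m P u w (dist u v + d)"

lemma theta_walk_snoc:
  assumes "theta_walk m P u v d" "theta_adj m P v w"
  shows "theta_walk m P u w (d + dist v w)"
  using assms
proof (induction rule: theta_walk.induct)
  case (refl u)
  then show ?case using theta_walk.step[OF refl theta_walk.refl] by simp
next
  case (step u v' v d)
  then show ?case using theta_walk.step[OF step(1)] by (metis add.assoc)
qed

text \<open>Adjacency forgets the direction of an edge. Reversal is what allows the extreme cone to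
  be treated from \<open>w\<close> towards \<open>v\<close>.\<close>

lemma theta_walk_sym:
  assumes "theta_walk m P u w d"
  shows "theta_walk m P w u d"
  using assms
proof (induction rule: theta_walk.induct)
  case (refl u)
  show ?case by (rule theta_walk.refl)
next
  case (step u v w d)
  then have "theta_adj m P v u" by (auto simp: theta_adj_def)
  from theta_walk_snoc[OF step.IH this] show ?case by (simp add: dist_commute add.commute)
qed

lemma theta_walk_imp_path:
  assumes "theta_walk m P u w d"
  shows "\<exists>ps. is_theta_path m P ps u w \<and> path_length ps = d"
  using assms
proof (induction rule: theta_walk.induct)
  case (refl u)
  have "is_theta_path m P [u] u u \<and> path_length [u] = 0" by (simp add: is_theta_path_def)
  then show ?case by blast
next
  case (step u v w d)
  then obtain ps where ps: "is_theta_path m P ps v w" "path_length ps = d" by blast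
  then obtain qs where qs: "ps = v # qs"
    by (cases ps) (auto simp: is_theta_path_def)
  have "is_theta_path m P (u # ps) u w"
    unfolding is_theta_path_def
  proof (intro conjI allI impI)
    fix j assume "Suc j < length (u # ps)"
    then show "theta_adj m P ((u # ps) ! j) ((u # ps) ! Suc j)"
      using ps(1) step(1) qs by (cases j) (auto simp: is_theta_path_def)
  qed (use ps(1) qs in \<open>auto simp: is_theta_path_def\<close>)
  then show ?case using ps(2) qs by (intro exI[of _ "u # ps"]) simp
qed

definition reach :: "nat \<Rightarrow> point set \<Rightarrow> point \<Rightarrow> point \<Rightarrow> real \<Rightarrow> bool" where
  "reach m P u w D \<longleftrightarrow> (\<exists>d\<le>D. theta_walk m P u w d)"

lemma reach_mono: "reach m P u w D \<Longrightarrow> D \<le> D' \<Longrightarrow> reach m P u w D'"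
  by (auto simp: reach_def intro: order_trans)

lemma reach_sym: "reach m P u w D \<Longrightarrow> reach m P w u D"
  by (auto simp: reach_def intro: theta_walk_sym)

lemma reach_step: "theta_adj m P u v \<Longrightarrow> reach m P v w D \<Longrightarrow> reach m P u w (dist u v + D)"
  unfolding reach_def by (meson add_left_mono theta_walk.step)

lemma reach_edge: "theta_adj m P u v \<Longrightarrow> reach m P u v (dist u v)"
  using reach_step[of m P u v v 0] by (auto simp: reach_def intro: theta_walk.refl)

section \<open>Cones as intersections of half-planes\<close>

locale theta_points =
  fixes k m :: nat and P :: "point set"
  assumes k_pos: "k \<ge> 1" and m_eq: "m = 4 * k + 2"
    and finite_P: "finite P" and gp: "general_position m P"
begin

abbreviation \<theta> :: real where "\<theta> \<equiv> cone_angle m"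

text \<open>The cone \<open>C\<^sub>l\<close> is the intersection of the half-planes with normals \<open>(l + k) \<theta>\<close> and
  \<open>(l - k) \<theta>\<close>, because \<open>k \<theta> = pi / 2 - \<theta> / 2\<close>. For \<open>s = 1\<close> (\<open>s = -1\<close>), \<open>corner_bound s l (w - u)\<close>
  is \<open>|ua| + |aw|\<close> for the left (right) corner \<open>a\<close> of \<open>T\<^sub>u\<^sub>w\<close>, and \<open>side_empty s\<close> refers to the part
  of \<open>T\<^sub>u\<^sub>w\<close> on that side of the cone of \<open>w\<close> opposite to \<open>C\<^sub>l\<close>.\<close>

definition R :: "real \<Rightarrow> point \<Rightarrow> real" where
  "R x p = along (x * \<theta>) p"

definition sector :: "int \<Rightarrow> point \<Rightarrow> bool" where
  "sector l p \<longleftrightarrow> R (l + k) p \<ge> 0 \<and> R (l - k) p \<ge> 0"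

definition corner_bound :: "int \<Rightarrow> int \<Rightarrow> point \<Rightarrow> real" where
  "corner_bound s l p = R (l + s * (k / 2)) p / sin (k * \<theta> / 2)"

definition side_empty :: "int \<Rightarrow> int \<Rightarrow> point \<Rightarrow> point \<Rightarrow> bool" where
  "side_empty s l u w \<longleftrightarrow>
     (\<forall>q\<in>P. sector l (q - u) \<longrightarrow> R l (w - q) \<ge> 0 \<longrightarrow> R (l - s * real k) (w - q) \<ge> 0)"

text \<open>The form of \<open>m\<close> enters here: a half turn is an odd number of cone angles,
  so the opposite of a cone is a cone, and a quarter turn is \<open>k + 1 / 2\<close> cone
  angles.\<close>

lemma theta_pi: "(2 * k + 1) * \<theta> = pi"
  by (simp add: cone_angle_def m_eq field_simps)

lemma theta_pos: "\<theta> > 0"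
  by (simp add: cone_angle_def m_eq)

lemma k_theta: "k * \<theta> = pi / 2 - \<theta> / 2"
  using theta_pi by (simp add: algebra_simps)

lemma sin_half_pos: "sin (k * \<theta> / 2) > 0"
proof (rule sin_gt_zero)
  show "0 < k * \<theta> / 2" using k_pos theta_pos by simp
  show "k * \<theta> / 2 < pi" using k_theta theta_pos pi_gt_zero by linarith
qed

lemma R_diff: "R x (p - q) = R x p - R x q"
  by (simp add: R_def along_diff)

lemma R_minus_commute: "R x (p - q) = - R x (q - p)"
  by (simp add: R_diff)

lemma R_opposite: "R (x + (2 * real k + 1)) p = - R x p"
proof -
  have "(x + (2 * real k + 1)) * \<theta> = x * \<theta> + pi"
    unfolding theta_pi[symmetric] by (simp add: algebra_simps)
  then show ?thesis by (simp add: R_def along_add_pi)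
qed

lemma R_opposite': "R (x - (2 * real k + 1)) p = - R x p"
  using R_opposite[of "x - (2 * real k + 1)" p] by simp

lemma R_period: "R (x + real m) p = R x p"
proof -
  have "x + real m = (x + (2 * real k + 1)) + (2 * real k + 1)" by (simp add: m_eq)
  then show ?thesis by (simp only: R_opposite minus_minus)
qed

text \<open>Cones are indexed by arbitrary integers so that turning and reversing are plain
  additions; periodicity links such an index to the bisector of its residue.\<close>

lemma R_bisector:
  fixes l :: int
  defines "i \<equiv> nat (l mod int m)"
  shows "R l p = p \<bullet> bisector m i" and "i < m"
proof -
  have m0: "0 < m" by (simp add: m_eq)
  then show "i < m" by (simp add: i_def nat_less_iff)
  have per: "R (x + real_of_int j * real m) p = R x p" for x :: real and j :: int
  proof (induction j rule: int_induct[where k = 0])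
    case base
    then show ?case by simp
  next
    case (step1 j)
    then show ?case using R_period[of "x + real_of_int j * real m" p] by (simp add: algebra_simps)
  next
    case (step2 j)
    then show ?case using R_period[of "x + real_of_int (j - 1) * real m" p] by (simp add: algebra_simps)
  qed
  have "real_of_int l = real i + real_of_int (l div int m) * m"
  proof -
    have "l = int i + (l div int m) * int m" using m0 by (simp add: i_def)
    then show ?thesis by (metis of_int_add of_int_mult of_int_of_nat_eq)
  qed
  then have "R l p = R (real i) p" using per by simp
  then show "R l p = p \<bullet> bisector m i" by (simp add: R_def along_def bisector_def)
qed

text \<open>Boundary normals are bisectors too, so this excludes points on cone boundaries as well
  as ties in height.\<close>

lemma R_nonzero:
  assumes "p \<in> P" "q \<in> P" "p \<noteq> q"
  shows "R (real_of_int l) (p - q) \<noteq> 0"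
  using assms gp R_bisector(1)[of l "p - q"] R_bisector(2)[of l] unfolding general_position_def by metis

lemma R_between:
  assumes "R a p \<ge> 0" "R b p \<ge> 0" "a \<le> x" "x \<le> b" "b - a < 2 * k + 1"
  shows "R x p \<ge> 0"
proof (cases "a < b")
  case True
  have lt: "(b - a) * \<theta> < pi"
    using assms(5) theta_pos theta_pi by (metis mult_strict_right_mono of_nat_1 of_nat_add of_nat_mult of_nat_numeral)
  have mono: "(x - a) * \<theta> \<le> (b - a) * \<theta>" "(b - x) * \<theta> \<le> (b - a) * \<theta>"
    using assms theta_pos by (auto intro: mult_right_mono)
  then have "(x - a) * \<theta> \<le> pi" "(b - x) * \<theta> \<le> pi" using lt by linarith+
  then have "sin ((b - x) * \<theta>) \<ge> 0" "sin ((x - a) * \<theta>) \<ge> 0"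
    using assms(3,4) theta_pos by (auto intro!: sin_ge_zero)
  then have "sin ((b - a) * \<theta>) * R x p \<ge> 0"
    using along_sine_rule[of "b * \<theta>" "a * \<theta>" "x * \<theta>" p] assms(1,2)
    by (simp add: R_def left_diff_distrib)
  moreover have "sin ((b - a) * \<theta>) > 0"
    using True lt theta_pos by (intro sin_gt_zero) auto
  ultimately show ?thesis by (simp add: zero_le_mult_iff)
next
  case False
  then have "x = a" using assms by simp
  then show ?thesis using assms by simp
qed

lemma sector_half_plane: "sector l p \<Longrightarrow> \<bar>x - real_of_int l\<bar> \<le> real k \<Longrightarrow> R x p \<ge> 0"
  by (rule R_between[of "l - k" p "l + k"]) (auto simp: sector_def abs_le_iff)

lemma theta_less_pi: "\<theta> < pi"
proof -
  have "1 * \<theta> < (2 * k + 1) * \<theta>" using k_pos theta_pos by (intro mult_strict_right_mono) auto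
  then show ?thesis using theta_pi by simp
qed

lemma cos_half_pos: "cos (\<theta> / 2) > 0"
  using theta_less_pi theta_pos by (intro cos_gt_zero) auto

text \<open>The two half-plane functionals have product
  \<open>(R l p)\<^sup>2 - (cos (\<theta> / 2) * norm p)\<^sup>2\<close> and sum a positive multiple
  of \<open>R l p\<close>. Both are nonnegative exactly when their product and sum are.\<close>

lemma sector_iff: "sector l p \<longleftrightarrow> cos (\<theta> / 2) * norm p \<le> R l p"
proof -
  let ?a = "R (l + k) p" and ?b = "R (l - k) p" and ?c = "cos (\<theta> / 2) * norm p"
  have sk: "sin (k * \<theta>) = cos (\<theta> / 2)" "cos (k * \<theta>) = sin (\<theta> / 2)"
    unfolding k_theta by (simp_all add: sin_diff cos_diff)
  have c: "?c \<ge> 0" using cos_half_pos by simp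
  have sp: "sin (\<theta> / 2) > 0"
    using theta_pos theta_less_pi by (intro sin_gt_zero) auto
  have prod: "?a * ?b = (R l p)\<^sup>2 - ?c\<^sup>2"
    using along_mult[of "l * \<theta>" "k * \<theta>" p]
    by (simp add: R_def sk distrib_right left_diff_distrib power_mult_distrib)
  have sum: "?a + ?b = 2 * sin (\<theta> / 2) * R l p"
    using along_add_angle[of "l * \<theta>" "k * \<theta>" p] along_add_angle[of "l * \<theta>" "- (k * \<theta>)" p]
    by (simp add: R_def sk distrib_right left_diff_distrib)
  show ?thesis
  proof
    assume "sector l p"
    then have ab: "?a \<ge> 0" "?b \<ge> 0" by (auto simp: sector_def)
    then have "R l p \<ge> 0" by (intro sector_half_plane[OF \<open>sector l p\<close>]) simp
    moreover have "?c\<^sup>2 \<le> (R l p)\<^sup>2" using prod mult_nonneg_nonneg[OF ab] by linarith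
    ultimately show "?c \<le> R l p" by (rule power2_le_imp_le[rotated])
  next
    assume le: "?c \<le> R l p"
    then have "?a * ?b \<ge> 0" using prod power_mono[OF le c, of 2] by linarith
    moreover have "?a + ?b \<ge> 0" using sum sp le c by simp
    ultimately show "sector l p"
      unfolding sector_def zero_le_mult_iff by linarith
  qed
qed

lemma sector_height_pos:
  assumes "sector l p" "p \<noteq> 0"
  shows "R l p > 0"
proof -
  have "0 < cos (\<theta> / 2) * norm p" using assms(2) cos_half_pos by simp
  then show ?thesis using assms(1) unfolding sector_iff by linarith
qed

lemma in_cone_iff: "in_cone m (nat (l mod int m)) u v \<longleftrightarrow> v \<noteq> u \<and> sector l (v - u)"
  using R_bisector(1)[of l "v - u"] R_bisector(2)[of l] by (auto simp: in_cone_def sector_iff)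

lemma proj_len_eq: "proj_len m (nat (l mod int m)) u v = R l (v - u)"
  using R_bisector(1)[of l "v - u"] by (simp add: proj_len_def)

lemma theta_edgeI:
  assumes "u \<in> P" "v \<in> P" "v \<noteq> u" "sector l (v - u)"
    and "\<And>x. x \<in> P \<Longrightarrow> x \<noteq> u \<Longrightarrow> sector l (x - u) \<Longrightarrow> R l (v - u) \<le> R l (x - u)"
  shows "theta_adj m P u v"
proof -
  have "theta_edge m P u v"
    unfolding theta_edge_def
    using assms R_bisector(2)[of l] in_cone_iff[of l] proj_len_eq[of l]
    by (intro conjI exI[of _ "nat (l mod int m)"]) auto
  then show ?thesis by (simp add: theta_adj_def)
qed

section \<open>Bounds through the corners of the canonical triangle\<close>

lemma corner_bound_diff: "corner_bound s l (w - u) = corner_bound s l (v - u) + corner_bound s l (w - v)"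
  by (simp add: corner_bound_def R_diff diff_divide_distrib)

text \<open>The square of the bound exceeds that of the distance by a product of two half-plane
  functionals which are both nonnegative on the cone.\<close>

lemma norm_le_corner_bound:
  assumes c: "sector l p" and s: "s = 1 \<or> s = -1"
  shows "norm p \<le> corner_bound s l p"
proof -
  let ?\<mu> = "k * \<theta> / 2"
  let ?g = "R (l + s * (k / 2)) p"
  have g: "?g \<ge> 0" by (rule sector_half_plane[OF c]) (use s in auto)
  have l: "R l p \<ge> 0" by (rule sector_half_plane[OF c]) auto
  have e: "R (l + s * k) p \<ge> 0" using c s by (auto simp: sector_def)
  have "R (l + s * k) p * R l p = ?g\<^sup>2 - (sin ?\<mu>)\<^sup>2 * (norm p)\<^sup>2"
  proof -
    have "l * \<theta> + s * (k / 2) * \<theta> + s * ?\<mu> = (l + s * k) * \<theta>"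
      "l * \<theta> + s * (k / 2) * \<theta> - s * ?\<mu> = l * \<theta>" by (simp_all add: algebra_simps)
    then show ?thesis
      using along_mult[of "l * \<theta> + s * (k / 2) * \<theta>" "s * ?\<mu>" p] s
      by (auto simp: R_def algebra_simps)
  qed
  then have "(sin ?\<mu> * norm p)\<^sup>2 \<le> ?g\<^sup>2"
    using mult_nonneg_nonneg[OF e l] by (simp add: power_mult_distrib)
  then have "sin ?\<mu> * norm p \<le> ?g" using g by (rule power2_le_imp_le)
  then show ?thesis using sin_half_pos by (simp add: corner_bound_def field_simps)
qed

section \<open>Cones turned by j steps\<close>

lemma exists_sector_on_side:
  assumes s: "s = 1 \<or> s = -1" and pos: "R (real_of_int l) p > 0" and out: "R (l - s * real k) p < 0"
  shows "\<exists>j::int. 1 \<le> j \<and> j \<le> k \<and> sector (l + s * j) p"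
proof -
  \<comment> \<open>These normals sweep from the one opposite to \<open>l - s * k\<close> (at 1) to
    the one opposite to \<open>l\<close> (at \<open>k + 1\<close>), so the sign changes from
    positive to negative. The first change locates the cone: \<open>f j\<close> and the reversed
    \<open>f (Suc j)\<close> are its two half-planes.\<close>
  define f where "f j = R (l + s * (k + real j)) p" for j
  have opp: "R (x + s * (2 * real k + 1)) p = - R x p" for x :: real
    using s
  proof
    assume "s = 1"
    then show ?thesis using R_opposite[of x p] by (simp add: add.commute)
  next
    assume s: "s = -1"
    have "x + real_of_int s * (2 * real k + 1) = x - (2 * real k + 1)" by (simp add: s)
    then show ?thesis by (simp only: R_opposite')
  qed
  have "f 1 > 0"
    using out opp[of "l - s * real k"] by (simp add: f_def algebra_simps)
  have fk: "f (Suc k) < 0"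
    using pos opp[of l] by (simp add: f_def algebra_simps)
  define j where "j = (LEAST j. f (Suc j) < 0)"
  have j: "f (Suc j) < 0" "j \<le> k"
    unfolding j_def using fk by (auto intro: LeastI Least_le)
  have j1: "j \<noteq> 0" using j(1) \<open>f 1 > 0\<close> by (cases j) auto
  have "f j \<ge> 0"
  proof (rule ccontr)
    assume "\<not> f j \<ge> 0"
    then have "f (Suc (j - 1)) < 0" using j1 by simp
    then have "j \<le> j - 1" unfolding j_def by (rule Least_le)
    then show False using j1 by simp
  qed
  moreover have "R (l + s * (real j - k)) p \<ge> 0"
    using j(1) opp[of "l + s * (real j - k)"] by (simp add: f_def algebra_simps)
  ultimately have "sector (l + s * int j) p"
    using s by (auto simp: sector_def f_def algebra_simps)
  then show ?thesis using j j1 by (intro exI[of _ "int j"]) auto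
qed

text \<open>The sum-to-product formula with the quarter turn measured in cone angles. For
  \<open>s = -1\<close> both factors change sign, so the product keeps its form.\<close>

lemma R_difference:
  fixes l a b :: real and s :: int
  assumes s: "s = 1 \<or> s = -1"
  shows "R (l + s * a) p - R (l + s * b) p
    = 2 * sin ((b - a) / 2 * \<theta>) * R (l + s * ((a + b) / 2 - (real k + 1 / 2))) p"
proof -
  have *: "R x p - R y p = 2 * sin ((y - x) / 2 * \<theta>) * R ((x + y) / 2 - (real k + 1 / 2)) p" for x y
  proof -
    have h: "pi / 2 = (real k + 1 / 2) * \<theta>" using theta_pi by (simp add: algebra_simps)
    show ?thesis
      using along_difference[of "x * \<theta>" p "y * \<theta>"] unfolding h
      by (simp add: R_def algebra_simps add_divide_distrib diff_divide_distrib)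
  qed
  show ?thesis
  proof (cases "s = 1")
    case True
    moreover have "(l + a + (l + b)) / 2 - (real k + 1 / 2) = l + ((a + b) / 2 - (real k + 1 / 2))"
      by (simp add: field_simps)
    ultimately show ?thesis using *[of "l + a" "l + b"] by (simp only: of_int_1 mult_1 add_diff_cancel_left)
  next
    case False
    then have s: "s = -1" using s by simp
    let ?x = "l + s * ((a + b) / 2 - (real k + 1 / 2))"
    have e: "(l - a + (l - b)) / 2 - (real k + 1 / 2) = ?x - (2 * real k + 1)"
      using s by (simp add: field_simps)
    have "R ((l - a + (l - b)) / 2 - (real k + 1 / 2)) p = - R ?x p"
      unfolding e by (rule R_opposite')
    moreover have "sin ((a - b) / 2 * \<theta>) = - sin ((b - a) / 2 * \<theta>)"
    proof -
      have "(a - b) / 2 * \<theta> = - ((b - a) / 2 * \<theta>)" by (simp add: field_simps)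
      then show ?thesis by (simp only: sin_minus)
    qed
    moreover have "R (l + s * a) p - R (l + s * b) p = R (l - a) p - R (l - b) p"
      using s by simp
    ultimately show ?thesis using *[of "l - a" "l - b"] by simp
  qed
qed

lemma corner_bound_rotate:
  assumes s: "s = 1 \<or> s = -1" and j: "1 \<le> j" "j < int k" and c: "sector (l + s * j) p"
  shows "max (corner_bound 1 (l + s * j) p) (corner_bound (-1) (l + s * j) p) \<le> corner_bound s l p"
proof -
  have k\<theta>: "real k * \<theta> < pi" using k_theta theta_pos pi_gt_zero by linarith
  have jr: "1 \<le> real_of_int j" "real_of_int j \<le> real k - 1" using j by linarith+
  have near: "R (l + s * x) p \<ge> 0" if "\<bar>x - j\<bar> \<le> k" for x :: real
    using s that by (intro sector_half_plane[OF c]) auto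
  have sin_j: "sin (x / 2 * \<theta>) \<ge> 0" if "0 \<le> x" "x \<le> k" for x :: real
  proof (rule sin_ge_zero)
    show "0 \<le> x / 2 * \<theta>" using that theta_pos by simp
    have "x / 2 * \<theta> \<le> real k * \<theta>" using that theta_pos by (intro mult_right_mono) auto
    then show "x / 2 * \<theta> \<le> pi" using k\<theta> by linarith
  qed
  \<comment> \<open>The resulting functional has offset \<open>(j - k - 1) / 2\<close>, which is
    \<open>(j + k + 1) / 2\<close> steps away from \<open>j\<close>. This is at most
    \<open>k\<close> because \<open>j < k\<close>; the extreme cone fails here.\<close>
  have "R (l + s * (k / 2)) p - R (l + s * (j + k / 2)) p \<ge> 0"
    unfolding R_difference[OF s]
    by (intro mult_nonneg_nonneg near sin_j) (use jr in \<open>auto simp: field_simps abs_le_iff\<close>)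
  moreover have "R (l + s * (k / 2)) p - R (l + s * (j - k / 2)) p \<ge> 0"
  proof -
    \<comment> \<open>The direction opposite to the one from \<open>R_difference\<close>. Its offset
      \<open>j / 2 + k + 1 / 2\<close> is within \<open>k\<close> of \<open>j\<close> because
      \<open>j \<ge> 1\<close>, so sine and functional are both nonpositive.\<close>
    let ?x = "l + s * ((k / 2 + (j - k / 2)) / 2 + (real k + 1 / 2))"
    have neg: "sin ((j - k / 2 - k / 2) / 2 * \<theta>) \<le> 0"
      using sin_j[of "k - j"] jr sin_minus[of "(k - j) / 2 * \<theta>"] by (simp add: algebra_simps diff_divide_distrib)
    have e: "l + s * ((k / 2 + (j - k / 2)) / 2 - (real k + 1 / 2)) = ?x - s * (2 * real k + 1)"
      by (simp add: algebra_simps)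
    have "R ?x p \<ge> 0" by (rule near) (use jr in \<open>auto simp: field_simps abs_le_iff\<close>)
    then have "R (l + s * ((k / 2 + (j - k / 2)) / 2 - (real k + 1 / 2))) p \<le> 0"
      unfolding e using s R_opposite[of ?x p] R_opposite'[of ?x p] by auto
    with neg show ?thesis
      unfolding R_difference[OF s] by (simp add: mult_nonpos_nonpos mult.assoc)
  qed
  ultimately have le: "R (l + s * j + k / 2) p \<le> R (l + s * (k / 2)) p"
    "R (l + s * j - k / 2) p \<le> R (l + s * (k / 2)) p"
    using s by (auto simp: algebra_simps)
  show ?thesis
    using sin_half_pos divide_right_mono[OF le(1)] divide_right_mono[OF le(2)]
    by (simp add: corner_bound_def)
qed

text \<open>Both heights are expanded in the two boundary functionals of the cone of
  \<open>u\<close>. For \<open>w - v\<close> one term is nonpositive, and the other has a smaller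
  coefficient and a smaller functional than its counterpart for \<open>w - u\<close>.\<close>

lemma height_decreases:
  fixes s l j :: int
  assumes s: "s = 1 \<or> s = -1" and j: "1 \<le> j" "j \<le> int k"
    and w: "R (l + s * real k) (w - u) \<ge> 0" "R (l - s * real k) (w - u) > 0"
    and v: "R (l + s * real k) (v - u) \<ge> 0" "R (l - s * real k) (w - v) \<le> 0"
  shows "R (l + s * j) (w - v) < R l (w - u)"
proof -
  have jr: "1 \<le> real_of_int j" "real_of_int j \<le> real k" using j by linarith+
  have rule: "sin (2 * k * \<theta>) * R (l + s * x) p
      = sin ((k - x) * \<theta>) * R (l - s * real k) p + sin ((k + x) * \<theta>) * R (l + s * real k) p"
    for x :: real and p
    using s along_sine_rule[of "(l + k) * \<theta>" "(l - k) * \<theta>" "(l + x) * \<theta>" p]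
      along_sine_rule[of "(l + k) * \<theta>" "(l - k) * \<theta>" "(l - x) * \<theta>" p]
    by (auto simp: R_def algebra_simps)
  have "2 * k * \<theta> = pi - \<theta>" using k_theta by simp
  then have s2: "sin (2 * k * \<theta>) = sin \<theta>" by simp
  note \<theta>1 = theta_less_pi
  have j\<theta>: "\<theta> \<le> real_of_int j * \<theta>" "real_of_int j * \<theta> \<le> k * \<theta>"
    using jr theta_pos by simp_all
  have "(real k - j) * \<theta> \<ge> 0" "(real k - j) * \<theta> \<le> pi" "(real k + j) * \<theta> \<ge> 0" "(real k + j) * \<theta> \<le> pi"
    unfolding left_diff_distrib distrib_right
    using j\<theta> \<theta>1 k_theta theta_pos by linarith+
  then have a: "sin ((real k - j) * \<theta>) \<ge> 0" and b: "sin ((real k + j) * \<theta>) \<ge> 0"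
    by (auto intro: sin_ge_zero)
  \<comment> \<open>The angle \<open>k * \<theta>\<close> is \<open>\<theta> / 2\<close> below a
    right angle, while \<open>(k + j) * \<theta>\<close> exceeds it by at least
    \<open>\<theta> / 2\<close>.\<close>
  have "cos ((real k + j) * \<theta> - pi / 2) \<le> cos (\<theta> / 2)"
    by (rule cos_monotone_0_pi_le) (use j\<theta> \<theta>1 k_theta theta_pos in \<open>auto simp: distrib_right\<close>)
  then have le: "sin ((real k + j) * \<theta>) \<le> sin (k * \<theta>)"
    by (simp add: cos_diff k_theta sin_diff)
  have pos: "sin (k * \<theta>) > 0"
    using k_theta cos_half_pos by (simp add: sin_diff)
  have d: "R (l + s * real k) (w - v) \<le> R (l + s * real k) (w - u)"
    using v(1) by (simp add: R_diff)
  have "sin \<theta> * R (l + s * j) (w - v) \<le> sin ((real k + j) * \<theta>) * R (l + s * real k) (w - v)"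
    using rule[of j "w - v"] s2 mult_nonneg_nonpos[OF a v(2)] by simp
  also have "\<dots> \<le> sin ((real k + j) * \<theta>) * R (l + s * real k) (w - u)"
    using d b by (rule mult_left_mono)
  also have "\<dots> \<le> sin (k * \<theta>) * R (l + s * real k) (w - u)"
    using le w(1) by (rule mult_right_mono)
  also have "\<dots> < sin (k * \<theta>) * R (l - s * real k) (w - u) + sin (k * \<theta>) * R (l + s * real k) (w - u)"
    using pos w(2) by simp
  also have "\<dots> = sin \<theta> * R l (w - u)"
    using rule[of 0 "w - u"] s2 by simp
  finally show ?thesis
    using sin_gt_zero[OF theta_pos \<theta>1] by simp
qed

section \<open>The extreme cone seen from its other end\<close>

lemma sector_opposite: "sector (l + (2 * int k + 1)) (v - w) \<longleftrightarrow> sector l (w - v)"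
proof -
  have "R (l + (2 * int k + 1) + k) (v - w) = R (l + k) (w - v)"
    "R (l + (2 * int k + 1) - k) (v - w) = R (l - k) (w - v)"
    using R_opposite[of "l + k" "v - w"] R_opposite[of "l - k" "v - w"]
      R_minus_commute[of _ v w] by (simp_all add: algebra_simps)
  then show ?thesis by (simp add: sector_def)
qed

text \<open>The corner direction, offset by \<open>k / 2\<close> back from the turned and reversed
  bisector, is exactly opposite to \<open>l + s * (k / 2)\<close>; reversing the vector cancels the
  sign.\<close>

lemma corner_bound_opposite:
  assumes s: "s = 1 \<or> s = -1"
  shows "corner_bound (- s) (l + s * k + (2 * int k + 1)) (v - w) = corner_bound s l (w - v)"
proof -
  have "real_of_int (l + s * k + (2 * int k + 1)) + real_of_int (- s) * (k / 2)
    = (l + s * (k / 2)) + (2 * real k + 1)" by (simp add: algebra_simps)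
  then show ?thesis
    by (simp only: corner_bound_def R_opposite R_minus_commute[of _ v w] minus_minus)
qed

text \<open>The side line of this region through \<open>v\<close> is perpendicular to the bisector
  of the cone of \<open>u\<close>. A point of the region below it would lie in that cone and be
  closer to \<open>u\<close> than \<open>v\<close>.\<close>

lemma side_empty_beyond_closest:
  assumes s: "s = 1 \<or> s = -1" and P: "u \<in> P" "v \<in> P" "u \<noteq> v"
    and v: "sector l (v - u)" and w: "sector l (w - u)"
    and closest: "\<And>x. x \<in> P \<Longrightarrow> x \<noteq> u \<Longrightarrow> sector l (x - u) \<Longrightarrow> R l (v - u) \<le> R l (x - u)"
  shows "side_empty s (l + s * k + (2 * int k + 1)) w v"
  unfolding side_empty_def
proof (intro ballI impI)
  fix q
  let ?c = "l + s * k + (2 * int k + 1)"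
  assume q: "q \<in> P" "sector ?c (q - w)" "R ?c (v - q) \<ge> 0"
  have "R (?c - s * real k) (v - q) = - R l (v - q)"
    using R_opposite[of l "v - q"] by (simp add: algebra_simps)
  moreover have "R l (v - q) \<le> 0"
  proof (rule ccontr)
    assume "\<not> R l (v - q) \<le> 0"
    then have lt: "R l (q - u) < R l (v - u)" by (simp add: R_diff)
    have qv: "R (l + s * real k) (q - v) \<ge> 0"
      using q(3) R_opposite[of "l + s * real k" "v - q"] R_minus_commute[of _ q v]
      by (simp add: algebra_simps)
    \<comment> \<open>This normal is one step from the bisector \<open>?c\<close>, after a full turn
      if \<open>s = 1\<close>.\<close>
    have near: "R (l - s * real k) (q - w) \<ge> 0"
      using s
    proof
      assume "s = 1"
      then have "R (l - s * real k + real m) (q - w) \<ge> 0"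
        using k_pos by (intro sector_half_plane[OF q(2)]) (auto simp: m_eq)
      then show ?thesis by (simp only: R_period)
    next
      assume "s = -1"
      then show ?thesis using k_pos by (intro sector_half_plane[OF q(2)]) auto
    qed
    have vu: "R (l + s * real k) (v - u) \<ge> 0" and wu: "R (l - s * real k) (w - u) \<ge> 0"
      using s v w by (auto simp: sector_def)
    have "R (l + s * real k) (q - u) \<ge> 0" "R (l - s * real k) (q - u) \<ge> 0"
      using qv near vu wu by (simp_all add: R_diff)
    then have "sector l (q - u)" using s by (auto simp: sector_def)
    \<comment> \<open>Otherwise \<open>u\<close> and \<open>v\<close> would lie on a common cone
      boundary line, against general position.\<close>
    moreover have "q \<noteq> u"
    proof
      assume "q = u"
      then have "R (l + s * real k) (v - u) = 0" using qv vu by (simp add: R_diff)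
      then show False using R_nonzero[of v u "l + s * int k"] P by simp
    qed
    ultimately have "R l (v - u) \<le> R l (q - u)" using closest q(1) by blast
    then show False using lt by simp
  qed
  ultimately show "R (?c - s * real k) (v - q) \<ge> 0" by simp
qed

section \<open>Induction on the rank of the height\<close>

definition heights :: "real set" where
  "heights = (\<lambda>(x, y, i). R (real i) (y - x)) ` (P \<times> P \<times> {..<m})"

text \<open>Counting the smaller realised heights turns a strict decrease of real heights into a
  decrease of natural numbers.\<close>

abbreviation rank :: "int \<Rightarrow> point \<Rightarrow> nat" where
  "rank l p \<equiv> card {h \<in> heights. h < R l p}"

lemma rank_less:
  assumes "u \<in> P" "w \<in> P" "R l (w - u) < R l' p"
  shows "rank l (w - u) < rank l' p"
proof -
  have "R l (w - u) = R (real (nat (l mod int m))) (w - u)"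
    using R_bisector(1)[of l "w - u"] by (simp add: R_def along_def bisector_def)
  then have "R l (w - u) \<in> heights"
    unfolding heights_def using assms R_bisector(2)[of l]
    by (intro image_eqI[of _ _ "(u, w, nat (l mod int m))"]) auto
  moreover have "finite heights" using finite_P by (simp add: heights_def)
  ultimately show ?thesis
    using assms(3) by (intro psubset_card_mono) auto
qed

text \<open>The conjunct on empty sides is needed only to strengthen the induction hypothesis: it
  serves the extreme cone \<open>j = k\<close>, in which the maximum of both bounds is too large.\<close>

lemma reach_bounds:
  assumes "u \<in> P" "w \<in> P" "u \<noteq> w" "sector l (w - u)"
  shows "(\<forall>s. (s = 1 \<or> s = -1) \<longrightarrow> side_empty s l u w
            \<longrightarrow> reach m P u w (corner_bound (- s) l (w - u))) \<and>
    reach m P u w (max (corner_bound 1 l (w - u)) (corner_bound (-1) l (w - u)))"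
  using assms
proof (induction "rank l (w - u)" arbitrary: l u w rule: less_induct)
  case less
  note u = less.prems(1) and w = less.prems(2) and uw = less.prems(3) and cw = less.prems(4)
  note IH = less.hyps[OF rank_less]
  let ?D = "\<lambda>s. corner_bound s l (w - u)"
  show ?case
  proof (cases "theta_adj m P u w")
    case True
    have "reach m P u w (?D s)" if "s = 1 \<or> s = -1" for s
      using reach_mono[OF reach_edge[OF True]] norm_le_corner_bound[OF cw that]
      by (simp add: dist_norm norm_minus_commute)
    then show ?thesis using reach_mono[of m P u w "?D 1"] by fastforce
  next
    case False
    define S where "S = {x \<in> P. x \<noteq> u \<and> sector l (x - u)}"
    have S: "finite S" "S \<noteq> {}" unfolding S_def using finite_P w uw[symmetric] cw by (simp, blast)
    define v where "v = arg_min_on (\<lambda>x. R l (x - u)) S"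
    have vS: "v \<in> S" "\<not> (\<exists>x\<in>S. R l (x - u) < R l (v - u))"
      using arg_min_if_finite[OF S, of "\<lambda>x. R l (x - u)"] by (simp_all add: v_def)
    then have v: "v \<in> P" "v \<noteq> u" "sector l (v - u)" by (auto simp: S_def)
    have closest: "R l (v - u) \<le> R l (x - u)" if "x \<in> P" "x \<noteq> u" "sector l (x - u)" for x
      proof -
      have "x \<in> S" using that by (simp add: S_def)
      then show ?thesis using vS(2) not_less by blast
    qed
    have uv: "theta_adj m P u v" using theta_edgeI[OF u v] closest by blast
    have "R l (v - u) < R l (w - u)"
    proof (rule ccontr)
      assume "\<not> ?thesis"
      then have "theta_adj m P u w"
        using closest uw by (intro theta_edgeI[OF u w _ cw]) force+
      then show False using False by simp
    qed
    then have wv: "R l (w - v) > 0" and vw: "v \<noteq> w" by (auto simp: R_diff)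
    have vu: "R l (v - u) > 0" using sector_height_pos v by simp
    have duv: "dist u v \<le> corner_bound s l (v - u)" if "s = 1 \<or> s = -1" for s
      using norm_le_corner_bound[OF v(3) that] by (simp add: dist_norm norm_minus_commute)
    show ?thesis
    proof (cases "sector l (w - v)")
      case True
      have "R l (w - v) < R l (w - u)" using vu by (simp add: R_diff)
      note ih = IH[OF v(1) w this v(1) w vw True]
      have "reach m P u w (?D (- s))" if s: "s = 1 \<or> s = -1" and e: "side_empty s l u w" for s
      proof -
        \<comment> \<open>The cone of \<open>v\<close> lies inside the parallel cone of
          \<open>u\<close>, so emptiness is inherited.\<close>
        have "sector l (q - u)" if "sector l (q - v)" for q
          using that v(3) by (simp add: sector_def R_diff)
        then have "side_empty s l v w" using e by (simp add: side_empty_def)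
        then have "reach m P v w (corner_bound (- s) l (w - v))" using ih s by blast
        moreover have "- s = 1 \<or> - s = -1" using s by auto
        ultimately show ?thesis
          using reach_mono[OF reach_step[OF uv]] duv
          by (metis add_right_mono corner_bound_diff)
      qed
      moreover have "reach m P u w (max (?D 1) (?D (-1)))"
      proof (rule reach_mono[OF reach_step[OF uv]])
        show "reach m P v w (max (corner_bound 1 l (w - v)) (corner_bound (-1) l (w - v)))"
          using ih by blast
        show "dist u v + max (corner_bound 1 l (w - v)) (corner_bound (-1) l (w - v)) \<le> max (?D 1) (?D (-1))"
          using duv[of 1] duv[of "-1"] corner_bound_diff[of 1 l w u v] corner_bound_diff[of "-1" l w u v]
          by (auto simp: max_def)
      qed
      ultimately show ?thesis by blast
    next
      case False
      then obtain s :: int where s: "s = 1 \<or> s = -1" and out: "R (l - s * real k) (w - v) < 0"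
        by (force simp: sector_def not_le intro: that[of 1] that[of "-1"])
      have wu: "R (l + s * real k) (w - u) \<ge> 0" "R (l - s * real k) (w - u) > 0"
        using s cw R_nonzero[OF w u uw[symmetric], of "l - s * int k"] by (auto simp: sector_def)
      have vu': "R (l + s * real k) (v - u) \<ge> 0"
        using s v(3) by (auto simp: sector_def)
      obtain j :: int where j: "1 \<le> j" "j \<le> k" and cj: "sector (l + s * j) (w - v)"
        using exists_sector_on_side[OF s wv out] by blast
      have dec: "R (l + s * j) (w - v) < R l (w - u)"
        using height_decreases[OF s j wu vu'] out by simp
      \<comment> \<open>The target keeps the index \<open>l\<close> of the cone of \<open>u\<close>,
        so that by additivity the edge to \<open>v\<close> completes it to
        \<open>?D s\<close>.\<close>
      have "reach m P v w (corner_bound s l (w - v))"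
      proof (cases "j = k")
        case False
        have "R (real_of_int (l + s * j)) (w - v) < R l (w - u)" using dec by simp
        note ih = IH[OF v(1) w this v(1) w vw cj, THEN conjunct2]
        show ?thesis
          using False j(2) by (intro reach_mono[OF ih] corner_bound_rotate[OF s j(1) _ cj]) simp
      next
        case True
        \<comment> \<open>The cone of \<open>w\<close> that contains \<open>v\<close>.\<close>
        let ?c = "l + s * k + (2 * int k + 1)"
        have "R (real_of_int ?c) (v - w) = R (l + s * j) (w - v)"
          using True R_opposite[of "l + s * real k" "v - w"] R_minus_commute[of _ v w]
          by (simp add: algebra_simps)
        then have lt: "R (real_of_int ?c) (v - w) < R l (w - u)" using dec by simp
        have "sector ?c (v - w)" using cj True sector_opposite by simp
        note ih = IH[OF w v(1) lt w v(1) vw[symmetric] this, THEN conjunct1]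
        have "side_empty s ?c w v"
          by (rule side_empty_beyond_closest[OF s u v(1) v(2)[symmetric] v(3) cw closest])
        then have "reach m P w v (corner_bound (- s) ?c (v - w))"
          using ih s by blast
        then show ?thesis using reach_sym corner_bound_opposite[OF s] by simp
      qed
      then have "reach m P u w (dist u v + corner_bound s l (w - v))" by (rule reach_step[OF uv])
      then have D: "reach m P u w (?D s)"
        by (rule reach_mono) (use duv[OF s] corner_bound_diff[of s l w u v] in simp)
      \<comment> \<open>The point \<open>v\<close> itself lies in the region on side
        \<open>s\<close>. Hence an empty side must be the other one, for which \<open>?D s\<close>
        is the bound demanded.\<close>
      have "\<not> side_empty s l u w"
        using v out wv by (force simp: side_empty_def)
      then have "reach m P u w (?D (- s'))" if "s' = 1 \<or> s' = -1" "side_empty s' l u w" for s'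
      proof -
        have "s' \<noteq> s" using \<open>\<not> side_empty s l u w\<close> that(2) by blast
        then have "- s' = s" using s that(1) by auto
        then show ?thesis using D by simp
      qed
      moreover have "reach m P u w (max (?D 1) (?D (-1)))"
        by (rule reach_mono[OF D]) (use s in auto)
      ultimately show ?thesis by blast
    qed
  qed
qed

section \<open>The bound in terms of the angle at u\<close>

lemma corner_bound_le:
  assumes s: "s = 1 \<or> s = -1"
  shows "corner_bound s l p
    \<le> (1 + sin (\<theta> / 2)) / cos (\<theta> / 2) * R l p + sqrt ((norm p)\<^sup>2 - (R l p)\<^sup>2)"
proof -
  let ?\<mu> = "k * \<theta> / 2" and ?X = "along (l * \<theta> + pi / 2) p"
  have X: "\<bar>?X\<bar> = sqrt ((norm p)\<^sup>2 - (R l p)\<^sup>2)"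
    unfolding R_def along_pythagoras[of "l * \<theta>" p, symmetric] by simp
  have "\<theta> / 2 = pi / 2 - 2 * ?\<mu>" using k_theta by linarith
  then have half: "sin (\<theta> / 2) = 2 * (cos ?\<mu>)\<^sup>2 - 1" "cos (\<theta> / 2) = 2 * sin ?\<mu> * cos ?\<mu>"
    using sin_cos_eq[of "2 * ?\<mu>"] cos_sin_eq[of "2 * ?\<mu>"]
    by (simp_all only: cos_double_cos sin_double of_real_eq_id id_apply)
  have "cos ?\<mu> \<noteq> 0" using half(2) cos_half_pos by auto
  \<comment> \<open>With \<open>\<theta> / 2\<close> complementary to twice \<open>?\<mu>\<close>,
    the constant of the theorem is the cotangent of \<open>?\<mu>\<close>.\<close>
  then have ratio: "(1 + sin (\<theta> / 2)) / cos (\<theta> / 2) = cos ?\<mu> / sin ?\<mu>"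
    unfolding half by (simp add: field_simps power2_eq_square)
  have "R (l + s * (k / 2)) p = cos ?\<mu> * R l p + s * sin ?\<mu> * ?X"
    using s along_add_angle[of "l * \<theta>" "s * ?\<mu>" p] by (auto simp: R_def algebra_simps)
  also have "\<dots> \<le> cos ?\<mu> * R l p + sin ?\<mu> * \<bar>?X\<bar>"
    using s sin_half_pos by (auto simp flip: mult_minus_right intro!: mult_left_mono)
  finally have "corner_bound s l p \<le> (cos ?\<mu> * R l p + sin ?\<mu> * \<bar>?X\<bar>) / sin ?\<mu>"
    unfolding corner_bound_def using sin_half_pos by (simp add: divide_right_mono)
  also have "\<dots> = cos ?\<mu> / sin ?\<mu> * R l p + \<bar>?X\<bar>"
    using sin_half_pos by (simp add: add_divide_distrib)
  finally show ?thesis unfolding ratio X .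
qed

end

theorem mainTheorem5:
  fixes k :: nat and P :: "point set" and u w :: point and i :: nat
  assumes "k \<ge> 1"
    and "m = 4 * k + 2"
    and "finite P"
    and "general_position m P"
    and "u \<in> P" and "w \<in> P" and "u \<noteq> w"
    and "in_cone m i u w"
  shows "\<exists>ps. is_theta_path m P ps u w \<and>
           path_length ps \<le>
             ((1 + sin (cone_angle m / 2)) / cos (cone_angle m / 2)
                * cos (vec_angle (w - u) (canon_mid m i u w - u))
              + sin (vec_angle (w - u) (canon_mid m i u w - u))) * dist u w"
proof -
  interpret theta_points k m P
    using assms by unfold_locales
  let ?p = "w - u" and ?Y = "proj_len m i u w" and ?\<alpha> = "vec_angle (w - u) (canon_mid m i u w - u)"
  have i: "i < m" using assms(8) by (simp add: in_cone_def)
  then have im: "nat (int i mod int m) = i" by simp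
  have sec: "sector (int i) ?p" and Y: "?Y = R (int i) ?p"
    using assms(8) in_cone_iff[of "int i" u w] proj_len_eq[of "int i" u w] im by auto
  have p: "norm ?p > 0" using assms(7) by simp
  have Ypos: "?Y > 0" using Y sector_height_pos[OF sec] assms(7) by simp
  have "norm (bisector m i) = 1"
    by (simp add: bisector_def cw_dir_def norm_prod_def)
  then have "?\<alpha> = arccos (?Y / norm ?p)"
    using Ypos by (simp add: vec_angle_def canon_mid_def flip: proj_len_def)
  moreover have "?Y \<le> norm ?p"
  proof (rule power2_le_imp_le)
    show "?Y\<^sup>2 \<le> (norm ?p)\<^sup>2"
      unfolding Y R_def along_pythagoras[of "int i * cone_angle m" ?p, symmetric] by simp
  qed simp
  then have "?Y / norm ?p \<le> 1" "-1 \<le> ?Y / norm ?p"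
    using p Ypos divide_pos_pos[OF Ypos p] by (simp, linarith)
  ultimately have \<alpha>: "cos ?\<alpha> = ?Y / norm ?p" "sin ?\<alpha> = sqrt (1 - (?Y / norm ?p)\<^sup>2)"
    by (simp_all only: cos_arccos sin_arccos)
  \<comment> \<open>Multiplied by the distance, the cosine gives the height of the canonical
    triangle and the sine gives the distance from \<open>w\<close> to the midpoint, the two
    quantities in \<open>corner_bound_le\<close>.\<close>
  have cY: "cos ?\<alpha> * norm ?p = R (int i) ?p" using \<alpha>(1) p Y by simp
  have "sqrt ((norm ?p)\<^sup>2 - ?Y\<^sup>2) = sqrt ((1 - (?Y / norm ?p)\<^sup>2) * (norm ?p)\<^sup>2)"
    using p by (simp add: field_simps)
  also have "\<dots> = sin ?\<alpha> * norm ?p" by (simp add: \<alpha>(2) real_sqrt_mult)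
  finally have sX: "sin ?\<alpha> * norm ?p = sqrt ((norm ?p)\<^sup>2 - (R (int i) ?p)\<^sup>2)" using Y by simp
  have "max (corner_bound 1 (int i) ?p) (corner_bound (-1) (int i) ?p)
      \<le> ((1 + sin (cone_angle m / 2)) / cos (cone_angle m / 2) * cos ?\<alpha> + sin ?\<alpha>) * norm ?p"
    unfolding distrib_right mult.assoc cY sX
    using corner_bound_le[of 1 "int i" ?p] corner_bound_le[of "-1" "int i" ?p] by simp
  then have "reach m P u w (((1 + sin (cone_angle m / 2)) / cos (cone_angle m / 2) * cos ?\<alpha> + sin ?\<alpha>) * norm ?p)"
    by (rule reach_mono[OF conjunct2[OF reach_bounds[OF assms(5,6,7) sec]]])
  then obtain d where "theta_walk m P u w d"
    "d \<le> ((1 + sin (cone_angle m / 2)) / cos (cone_angle m / 2) * cos ?\<alpha> + sin ?\<alpha>) * norm ?p"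
    unfolding reach_def by blast
  moreover have "norm ?p = dist u w" by (simp add: dist_norm norm_minus_commute)
  ultimately show ?thesis
    using theta_walk_imp_path[of m P u w d] by auto
qed

end
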